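(* Let $F$ be a field of characteristic different from $2$ and $3$, let $a\in F$ with $a\neq 0$, and let $E:\ y^2=x^3+ax$ (an elliptic curve with $j$-invariant $1728$). Let $f(t)=t^4+ct+d$ with $c,d\in F$, $c\neq 0$, $d\neq 0$. Consider the surface over $F$ which is the total space of the quadratic-twist pencil $E^{f(t)}$, with affine equation $f(t)y^2=x^3+ax$. Then this surface contains a curve $C$ given (inside the surface) by the additional equation $(ct+d)y^2=ax$, and $C$ has an irreducible component $C_1$ given by $y=0$ and another irreducible component $C_2$ which is a rational curve.
   Context: The pencil $E^{f(t)}$ is the family over the $t$-line whose fibre over $t$ is the quadratic twist $f(t)y^2=x^3+ax$. A rational curve is an integral curve whose desingularisation has genus $0$ and which has a smooth $F$-rational point. *)

theory Defs
  imports "HOL-Computational_Algebra.Polynomial" "HOL-Computational_Algebra.Fraction_Field"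
begin

definition is_ideal :: "'b::comm_ring_1 set \<Rightarrow> bool" where
  "is_ideal I \<longleftrightarrow> 0 \<in> I \<and> (\<forall>a\<in>I. \<forall>b\<in>I. a + b \<in> I) \<and> (\<forall>r. \<forall>a\<in>I. r * a \<in> I)"

definition ideal_gen :: "'b::comm_ring_1 set \<Rightarrow> 'b set" where
  "ideal_gen S = \<Inter>{I. is_ideal I \<and> S \<subseteq> I}"

definition prime_ideal :: "'b::comm_ring_1 set \<Rightarrow> bool" where
  "prime_ideal P \<longleftrightarrow> is_ideal P \<and> 1 \<notin> P \<and> (\<forall>a b. a * b \<in> P \<longrightarrow> a \<in> P \<or> b \<in> P)"

(* P is a minimal prime over I, i.e. V(P) is an irreducible component of V(I) = Spec(R/I) *)
definition minimal_prime_over :: "'b::comm_ring_1 set \<Rightarrow> 'b set \<Rightarrow> bool" where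
  "minimal_prime_over I P \<longleftrightarrow> prime_ideal P \<and> I \<subseteq> P \<and>
     (\<forall>Q. prime_ideal Q \<and> I \<subseteq> Q \<and> Q \<subseteq> P \<longrightarrow> Q = P)"

definition radical :: "'b::comm_ring_1 set \<Rightarrow> 'b set" where
  "radical I = {a. \<exists>n. a ^ n \<in> I}"

(* The polynomial ring F[t,x,y] is  'a poly poly poly : outermost variable y,
   middle variable x, innermost variable t. *)
definition cnst :: "'a::field \<Rightarrow> 'a poly poly poly" where
  "cnst c = [:[:[:c:]:]:]"

definition var_t :: "'a::field poly poly poly" where
  "var_t = [:[:[:0, 1:]:]:]"

definition var_x :: "'a::field poly poly poly" where
  "var_x = [:[:0, 1:]:]"

definition var_y :: "'a::field poly poly poly" where
  "var_y = [:0, 1:]"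

(* The F-algebra homomorphism F[t,x,y] -> F(s) sending t,x,y to T,X,Y.
   F(s) is the rational function field  'a poly fract. *)
definition ev3 :: "'a::field poly fract \<Rightarrow> 'a poly fract \<Rightarrow> 'a poly fract
                   \<Rightarrow> 'a poly poly poly \<Rightarrow> 'a poly fract" where
  "ev3 T X Y p =
     poly (map_poly (\<lambda>q. poly (map_poly (\<lambda>r. poly (map_poly (\<lambda>c. Fract [:c:] 1) r) T) q) X) p) Y"

(* The integral closed subscheme V(P) of affine 3-space over F is a rational curve:
   its function field (fraction field of F[t,x,y]/P) is F-isomorphic to F(s),
   i.e. there is an F-algebra map F[t,x,y] -> F(s) with kernel P whose image
   generates F(s) as a field. *)
definition rational_curve_ideal :: "'a::field poly poly poly set \<Rightarrow> bool" where
  "rational_curve_ideal P \<longleftrightarrow>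
     (\<exists>T X Y. {p. ev3 T X Y p = 0} = P \<and>
        (\<forall>z. \<exists>p q. ev3 T X Y q \<noteq> 0 \<and> z = ev3 T X Y p / ev3 T X Y q))"

end

(*
  Modulo G = (c t + d) y^2 - a x one has a x = (c t + d) y^2 and S - G = t^4 y^2 - x^3, so
  eliminating x gives y^2 h in (S, G) for h = a^3 t^4 - (c t + d)^3 y^4.  Hence every prime
  over (S, G) contains y, and then also x, or it contains h.  The first alternative gives the
  component C1 = V(x, y).  The second component C2 is the kernel of the substitution
  t |-> (a s^4 - d)/c, x |-> t^2/s^2, y |-> t/s^3 into F(s), which generates F(s) since
  s = x/(t y); so C2 is rational.  A prime Q over (S, G) inside this kernel does not contain y,
  hence contains h and G.  Eliminating x modulo G and pseudo-dividing by h as a polynomial in y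
  reduces any element of the kernel modulo Q to a remainder of y-degree below 4, and that
  remainder is 0 because 1, Y, Y^2, Y^3 are linearly independent over F(T): the s-degrees of
  T^i s^(9-3i) lie in distinct classes modulo 4.  So the kernel is contained in Q.
*)

theory Submission
  imports Defs "HOL-Computational_Algebra.Polynomial_Factorial"
begin

definition ring_hom_fn :: "('a::comm_ring_1 \<Rightarrow> 'b::comm_ring_1) \<Rightarrow> bool" where
  "ring_hom_fn f \<longleftrightarrow>
     f 0 = 0 \<and> f 1 = 1 \<and> (\<forall>x y. f (x + y) = f x + f y) \<and> (\<forall>x y. f (x * y) = f x * f y)"

lemma ring_hom_fnD:
  assumes "ring_hom_fn f"
  shows "f 0 = 0" "f 1 = 1" "f (x + y) = f x + f y" "f (x * y) = f x * f y"
    and "f (- x) = - f x" "f (x - y) = f x - f y" "f (x ^ n) = f x ^ n"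
proof -
  show "f 0 = 0" "f 1 = 1" "f (x + y) = f x + f y" "f (x * y) = f x * f y"
    using assms by (auto simp: ring_hom_fn_def)
  have uminus: "f (- z) = - f z" for z
    using assms unfolding ring_hom_fn_def
    by (metis add.right_inverse add_eq_0_iff2)
  show "f (- x) = - f x" by (rule uminus)
  show "f (x - y) = f x - f y"
    using assms uminus unfolding ring_hom_fn_def by (metis diff_conv_add_uminus)
  show "f (x ^ n) = f x ^ n"
    using assms by (induct n) (auto simp: ring_hom_fn_def)
qed

lemma ring_hom_fn_id: "ring_hom_fn (\<lambda>x. x)"
  by (simp add: ring_hom_fn_def)

lemma ring_hom_fn_comp: "ring_hom_fn f \<Longrightarrow> ring_hom_fn g \<Longrightarrow> ring_hom_fn (g \<circ> f)"
  by (simp add: ring_hom_fn_def)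

lemma prime_ideal_kernel:
  fixes f :: "'a::comm_ring_1 \<Rightarrow> 'b::idom"
  assumes "ring_hom_fn f"
  shows "prime_ideal {p. f p = 0}"
  using ring_hom_fnD[OF assms] by (auto simp: prime_ideal_def is_ideal_def)

definition eval_poly_hom :: "('a::comm_ring_1 \<Rightarrow> 'b::comm_ring_1) \<Rightarrow> 'b \<Rightarrow> 'a poly \<Rightarrow> 'b" where
  "eval_poly_hom f x p = poly (map_poly f p) x"

lemma eval_poly_hom_0 [simp]: "eval_poly_hom f x 0 = 0"
  by (simp add: eval_poly_hom_def)

lemma eval_poly_hom_pCons:
  "f 0 = 0 \<Longrightarrow> eval_poly_hom f x (pCons c p) = f c + x * eval_poly_hom f x p"
  by (simp add: eval_poly_hom_def map_poly_pCons)

lemma eval_poly_hom_const: "f 0 = 0 \<Longrightarrow> eval_poly_hom f x [:c:] = f c"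
  by (simp add: eval_poly_hom_pCons)

lemma eval_poly_hom_X: "ring_hom_fn f \<Longrightarrow> eval_poly_hom f x [:0, 1:] = x"
  by (simp add: eval_poly_hom_pCons eval_poly_hom_const ring_hom_fnD)

lemma ring_hom_eval_poly_hom:
  assumes "ring_hom_fn f"
  shows "ring_hom_fn (eval_poly_hom f x)"
proof -
  note f = ring_hom_fnD[OF assms]
  have eval_pCons: "eval_poly_hom f x (pCons c p) = f c + x * eval_poly_hom f x p" for c p
    by (rule eval_poly_hom_pCons[where f = f, OF f(1)])
  have add: "eval_poly_hom f x (p + q) = eval_poly_hom f x p + eval_poly_hom f x q" for p q
    by (induct p q rule: poly_induct2) (simp_all add: eval_pCons f algebra_simps)
  have smult: "eval_poly_hom f x (smult c q) = f c * eval_poly_hom f x q" for c q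
    by (induct q) (simp_all add: eval_pCons f algebra_simps)
  have mult: "eval_poly_hom f x (p * q) = eval_poly_hom f x p * eval_poly_hom f x q" for p q
  proof (induct p)
    case (pCons c p)
    have "pCons c p * q = smult c q + pCons 0 (p * q)" by simp
    then show ?case using pCons by (simp only: add smult) (simp add: eval_pCons f algebra_simps)
  qed simp
  show ?thesis
    using add mult f by (simp add: ring_hom_fn_def eval_poly_hom_def)
qed

lemma eval_poly_hom_comp:
  assumes "ring_hom_fn g" "f 0 = 0"
  shows "g (eval_poly_hom f x p) = eval_poly_hom (g \<circ> f) (g x) p"
  using ring_hom_fnD[OF assms(1)] assms(2)
  by (induct p) (simp_all add: eval_poly_hom_pCons)

lemma eval_poly_hom_monom:
  assumes "ring_hom_fn f"
  shows "eval_poly_hom f x (monom c n) = f c * x ^ n"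
proof -
  have "monom c n = [:c:] * [:0, 1:] ^ n" by (simp add: monom_altdef)
  then show ?thesis
    by (simp only: ring_hom_fnD(4,7)[OF ring_hom_eval_poly_hom[OF assms]] eval_poly_hom_X[OF assms]
        eval_poly_hom_const[where f = f, OF ring_hom_fnD(1)[OF assms]])
qed

lemma is_ideal_ideal_gen: "is_ideal (ideal_gen S)"
  unfolding ideal_gen_def is_ideal_def by auto

lemma ideal_gen_superset: "S \<subseteq> ideal_gen S"
  unfolding ideal_gen_def by auto

lemma ideal_gen_least: "is_ideal I \<Longrightarrow> S \<subseteq> I \<Longrightarrow> ideal_gen S \<subseteq> I"
  unfolding ideal_gen_def by auto

lemma is_ideal_zero: "is_ideal I \<Longrightarrow> 0 \<in> I"
  unfolding is_ideal_def by auto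

lemma is_ideal_add: "is_ideal I \<Longrightarrow> a \<in> I \<Longrightarrow> b \<in> I \<Longrightarrow> a + b \<in> I"
  unfolding is_ideal_def by auto

lemma is_ideal_mult_left: "is_ideal I \<Longrightarrow> a \<in> I \<Longrightarrow> r * a \<in> I"
  unfolding is_ideal_def by auto

lemma is_ideal_mult_right: "is_ideal I \<Longrightarrow> a \<in> I \<Longrightarrow> a * r \<in> I"
  unfolding is_ideal_def by (metis mult.commute)

lemma is_ideal_diff: "is_ideal I \<Longrightarrow> a \<in> I \<Longrightarrow> b \<in> I \<Longrightarrow> a - b \<in> I"
  using is_ideal_add is_ideal_mult_left[of I b "- 1"] by (metis diff_conv_add_uminus mult_minus1)

lemma prime_idealD: "prime_ideal P \<Longrightarrow> a * b \<in> P \<Longrightarrow> a \<in> P \<or> b \<in> P"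
  unfolding prime_ideal_def by blast

lemma prime_ideal_is_ideal: "prime_ideal P \<Longrightarrow> is_ideal P"
  unfolding prime_ideal_def by blast

lemma ring_hom_const_poly: "ring_hom_fn (\<lambda>c::'a::comm_ring_1. [:c:])"
  unfolding ring_hom_fn_def by (simp add: one_pCons mult.commute)

lemma ring_hom_to_fract: "ring_hom_fn to_fract"
  unfolding ring_hom_fn_def by simp

lemma ring_hom_const_poly_poly: "ring_hom_fn (\<lambda>c::'a::comm_ring_1. [:[:c:]:])"
  using ring_hom_fn_comp[OF ring_hom_const_poly ring_hom_const_poly] by (simp add: comp_def)

lemma ring_hom_cnst: "ring_hom_fn cnst"
  using ring_hom_fn_comp[OF ring_hom_const_poly_poly ring_hom_const_poly]
  by (simp add: comp_def cnst_def[abs_def])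

lemma poly3_induct [case_names cnst var_t var_x var_y add mult]:
  assumes cnst: "\<And>c. P (cnst c)" and t: "P var_t" and x: "P var_x" and y: "P var_y"
    and add: "\<And>p q. P p \<Longrightarrow> P q \<Longrightarrow> P (p + q)"
    and mult: "\<And>p q. P p \<Longrightarrow> P q \<Longrightarrow> P (p * q)"
  shows "P p"
proof -
  have zero: "P 0" using cnst[of 0] by (simp add: cnst_def)
  have in_t: "P [:[:u:]:]" for u
  proof (induct u)
    case (pCons c u)
    have "[:[:pCons c u:]:] = cnst c + var_t * [:[:u:]:]"
      by (simp add: cnst_def var_t_def)
    then show ?case using pCons by (metis add mult cnst t)
  qed (simp add: zero)
  have in_tx: "P [:w:]" for w
  proof (induct w)
    case (pCons u w)
    have "[:pCons u w:] = [:[:u:]:] + var_x * [:w:]"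
      by (simp add: var_x_def)
    then show ?case using pCons by (metis add mult in_t x)
  qed (simp add: zero)
  show ?thesis
  proof (induct p)
    case (pCons w p)
    have "pCons w p = [:w:] + var_y * p"
      by (simp add: var_y_def)
    then show ?case using pCons by (metis add mult in_tx y)
  qed (rule zero)
qed

definition eval3 :: "('a::field \<Rightarrow> 'b::comm_ring_1) \<Rightarrow> 'b \<Rightarrow> 'b \<Rightarrow> 'b \<Rightarrow> 'a poly poly poly \<Rightarrow> 'b" where
  "eval3 f T X Y = eval_poly_hom (eval_poly_hom (eval_poly_hom f T) X) Y"

lemma ring_hom_eval3: "ring_hom_fn f \<Longrightarrow> ring_hom_fn (eval3 f T X Y)"
  unfolding eval3_def by (intro ring_hom_eval_poly_hom)

lemma eval3_simps:
  assumes "ring_hom_fn f"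
  shows "eval3 f T X Y (cnst c) = f c" "eval3 f T X Y var_t = T"
    and "eval3 f T X Y var_x = X" "eval3 f T X Y var_y = Y"
  using ring_hom_fnD(1)[OF assms] ring_hom_fnD(1)[OF ring_hom_eval_poly_hom[OF assms]]
    ring_hom_fnD(1)[OF ring_hom_eval_poly_hom[OF ring_hom_eval_poly_hom[OF assms]]]
    eval_poly_hom_X[OF assms] eval_poly_hom_X[OF ring_hom_eval_poly_hom[OF assms]]
    eval_poly_hom_X[OF ring_hom_eval_poly_hom[OF ring_hom_eval_poly_hom[OF assms]]]
  by (simp_all add: eval3_def cnst_def var_t_def var_x_def var_y_def eval_poly_hom_const)

lemma ev3_eq_eval3: "ev3 T X Y = eval3 (\<lambda>c. to_fract [:c:]) T X Y"
  unfolding ev3_def eval3_def eval_poly_hom_def to_fract_def ..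

lemma ring_hom_to_fract_const: "ring_hom_fn (\<lambda>c::'a::field. to_fract [:c:])"
  using ring_hom_fn_comp[OF ring_hom_const_poly ring_hom_to_fract] by (simp add: comp_def)

lemma ring_hom_ev3: "ring_hom_fn (ev3 T X Y)"
  unfolding ev3_eq_eval3 by (intro ring_hom_eval3 ring_hom_to_fract_const)

lemma ev3_simps:
  "ev3 T X Y (cnst c) = to_fract [:c:]" "ev3 T X Y var_t = T"
  "ev3 T X Y var_x = X" "ev3 T X Y var_y = Y"
  unfolding ev3_eq_eval3 using eval3_simps[OF ring_hom_to_fract_const] by auto

lemma ring_hom_diff_in_ideal:
  assumes "ring_hom_fn \<phi>" "ring_hom_fn \<psi>" "is_ideal Q"
    and "\<And>c. \<phi> (cnst c) - \<psi> (cnst c) \<in> Q" "\<phi> var_t - \<psi> var_t \<in> Q"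
    and "\<phi> var_x - \<psi> var_x \<in> Q" "\<phi> var_y - \<psi> var_y \<in> Q"
  shows "\<phi> p - \<psi> p \<in> Q"
proof (induct p rule: poly3_induct)
  case (add p q)
  have "\<phi> (p + q) - \<psi> (p + q) = (\<phi> p - \<psi> p) + (\<phi> q - \<psi> q)"
    by (simp add: ring_hom_fnD[OF assms(1)] ring_hom_fnD[OF assms(2)])
  then show ?case using add is_ideal_add[OF assms(3)] by simp
next
  case (mult p q)
  have "\<phi> (p * q) - \<psi> (p * q) = \<phi> p * (\<phi> q - \<psi> q) + (\<phi> p - \<psi> p) * \<psi> q"
    by (simp add: ring_hom_fnD[OF assms(1)] ring_hom_fnD[OF assms(2)] algebra_simps)
  then show ?case
    using mult is_ideal_add[OF assms(3)] is_ideal_mult_left[OF assms(3)]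
      is_ideal_mult_right[OF assms(3)] by simp
qed (use assms in auto)

definition fraction_image :: "('a::comm_ring_1 \<Rightarrow> 'b::field) \<Rightarrow> 'b set" where
  "fraction_image \<phi> = {\<phi> p / \<phi> q | p q. \<phi> q \<noteq> 0}"

context
  fixes \<phi> :: "'a::comm_ring_1 \<Rightarrow> 'b::field"
  assumes hom: "ring_hom_fn \<phi>"
begin

lemma fraction_image_hom: "\<phi> p \<in> fraction_image \<phi>"
  unfolding fraction_image_def using ring_hom_fnD[OF hom]
  by (intro CollectI exI[of _ p] exI[of _ 1]) simp

lemma fraction_image_add:
  assumes "z \<in> fraction_image \<phi>" "w \<in> fraction_image \<phi>"
  shows "z + w \<in> fraction_image \<phi>"
proof -
  obtain p q p' q' where "\<phi> q \<noteq> 0" "z = \<phi> p / \<phi> q" "\<phi> q' \<noteq> 0" "w = \<phi> p' / \<phi> q'"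
    using assms unfolding fraction_image_def by blast
  then show ?thesis unfolding fraction_image_def using ring_hom_fnD[OF hom]
    by (intro CollectI exI[of _ "p * q' + p' * q"] exI[of _ "q * q'"]) (simp add: field_simps)
qed

lemma fraction_image_mult:
  assumes "z \<in> fraction_image \<phi>" "w \<in> fraction_image \<phi>"
  shows "z * w \<in> fraction_image \<phi>"
proof -
  obtain p q p' q' where "\<phi> q \<noteq> 0" "z = \<phi> p / \<phi> q" "\<phi> q' \<noteq> 0" "w = \<phi> p' / \<phi> q'"
    using assms unfolding fraction_image_def by blast
  then show ?thesis unfolding fraction_image_def using ring_hom_fnD[OF hom]
    by (intro CollectI exI[of _ "p * p'"] exI[of _ "q * q'"]) simp
qed

lemma fraction_image_divide:
  assumes "z \<in> fraction_image \<phi>" "w \<in> fraction_image \<phi>"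
  shows "z / w \<in> fraction_image \<phi>"
proof (cases "w = 0")
  case True
  then show ?thesis using fraction_image_hom[of 0] ring_hom_fnD(1)[OF hom] by simp
next
  case False
  obtain p q p' q' where "\<phi> q \<noteq> 0" "z = \<phi> p / \<phi> q" "\<phi> q' \<noteq> 0" "w = \<phi> p' / \<phi> q'"
    using assms unfolding fraction_image_def by blast
  with False show ?thesis unfolding fraction_image_def using ring_hom_fnD[OF hom]
    by (intro CollectI exI[of _ "p * q'"] exI[of _ "q * p'"]) simp
qed

end

definition supp_dvd :: "nat \<Rightarrow> 'a::comm_ring_1 poly \<Rightarrow> bool" where
  "supp_dvd m A \<longleftrightarrow> (\<forall>n. \<not> m dvd n \<longrightarrow> coeff A n = 0)"

lemma supp_dvdD: "supp_dvd m A \<Longrightarrow> \<not> m dvd n \<Longrightarrow> coeff A n = 0"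
  unfolding supp_dvd_def by blast

lemma supp_dvd_0: "supp_dvd m 0"
  unfolding supp_dvd_def by simp

lemma supp_dvd_const: "supp_dvd m [:c:]"
  unfolding supp_dvd_def by (auto simp: coeff_pCons split: nat.splits)

lemma supp_dvd_add: "supp_dvd m A \<Longrightarrow> supp_dvd m B \<Longrightarrow> supp_dvd m (A + B)"
  unfolding supp_dvd_def by simp

lemma supp_dvd_mult:
  assumes "supp_dvd m A" "supp_dvd m B"
  shows "supp_dvd m (A * B)"
  unfolding supp_dvd_def
proof (intro allI impI)
  fix n assume n: "\<not> m dvd n"
  have "coeff A i * coeff B (n - i) = 0" if "i \<le> n" for i
  proof (cases "m dvd i")
    case True
    with n that have "\<not> m dvd (n - i)" using dvd_diffD by blast
    then show ?thesis using supp_dvdD[OF assms(2)] by simp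
  qed (simp add: supp_dvdD[OF assms(1)])
  then show "coeff (A * B) n = 0" unfolding coeff_mult by simp
qed

lemma supp_dvd_power: "supp_dvd m A \<Longrightarrow> supp_dvd m (A ^ n)"
  by (induct n) (simp_all add: supp_dvd_mult supp_dvd_const one_pCons)

lemma supp_dvd_pcompose: "supp_dvd m B \<Longrightarrow> supp_dvd m (pcompose u B)"
  by (induct u) (simp_all add: pcompose_pCons supp_dvd_0 supp_dvd_add supp_dvd_mult supp_dvd_const)

text \<open>Polynomials supported on multiples of \<open>m\<close>, shifted by exponents that are pairwise
  incongruent modulo \<open>m\<close>, have disjoint supports.\<close>
lemma sum_shifted_supp_dvd_eq_0:
  assumes I: "finite I" and supp: "\<And>i. i \<in> I \<Longrightarrow> supp_dvd m (A i)"
    and inj: "inj_on (\<lambda>i. k i mod m) I"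
    and sum: "(\<Sum>i\<in>I. monom 1 (k i) * A i) = 0"
    and j: "j \<in> I"
  shows "A j = 0"
proof (rule poly_eqI)
  fix n
  show "coeff (A j) n = coeff 0 n"
  proof (cases "m dvd n")
    case True
    have other: "coeff (monom 1 (k i) * A i) (n + k j) = 0" if i: "i \<in> I - {j}" for i
    proof (cases "k i \<le> n + k j")
      case le: True
      have "\<not> m dvd (n + k j - k i)"
      proof
        assume "m dvd (n + k j - k i)"
        then obtain q where q: "n + k j - k i = m * q" by blast
        obtain r where r: "n = m * r" using True by blast
        have "k j + m * r = k i + m * q" using q r le by linarith
        then have "(k j + m * r) mod m = (k i + m * q) mod m" by simp
        then have "k i mod m = k j mod m" by simp
        with inj i j show False by (auto dest: inj_onD)
      qed
      with le show ?thesis using supp_dvdD[OF supp] i by (simp add: coeff_monom_mult)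
    qed (simp add: coeff_monom_mult)
    have "0 = coeff (\<Sum>i\<in>I. monom 1 (k i) * A i) (n + k j)" by (simp add: sum)
    also have "\<dots> = coeff (monom 1 (k j) * A j) (n + k j)"
      using I j other by (simp add: coeff_sum sum.remove)
    also have "\<dots> = coeff (A j) n" by (simp add: coeff_monom_mult)
    finally show ?thesis by simp
  qed (simp add: supp_dvdD[OF supp[OF j]])
qed

definition eval_xy0 :: "'a::field poly poly poly \<Rightarrow> 'a poly" where
  "eval_xy0 = eval3 (\<lambda>c. [:c:]) [:0, 1:] 0 0"

lemma ring_hom_eval_xy0: "ring_hom_fn eval_xy0"
  unfolding eval_xy0_def by (intro ring_hom_eval3 ring_hom_const_poly)

lemma eval_xy0_simps:
  "eval_xy0 (cnst c) = [:c:]" "eval_xy0 var_t = [:0, 1:]" "eval_xy0 var_x = 0" "eval_xy0 var_y = 0"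
  unfolding eval_xy0_def by (simp_all add: eval3_simps[OF ring_hom_const_poly])

definition embed_t :: "'a::field poly \<Rightarrow> 'a poly poly poly" where
  "embed_t = eval_poly_hom cnst var_t"

lemma ring_hom_embed_t: "ring_hom_fn embed_t"
  unfolding embed_t_def by (intro ring_hom_eval_poly_hom ring_hom_cnst)

lemma embed_t_simps: "embed_t [:c:] = cnst c" "embed_t [:0, 1:] = var_t"
  unfolding embed_t_def
  using eval_poly_hom_const[of cnst] eval_poly_hom_X[OF ring_hom_cnst] ring_hom_fnD[OF ring_hom_cnst]
  by auto

definition embed_ty :: "'a::field poly poly \<Rightarrow> 'a poly poly poly" where
  "embed_ty = eval_poly_hom embed_t var_y"

lemma ring_hom_embed_ty: "ring_hom_fn embed_ty"
  unfolding embed_ty_def by (intro ring_hom_eval_poly_hom ring_hom_embed_t)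

lemma embed_ty_simps: "embed_ty [:u:] = embed_t u" "embed_ty [:0, 1:] = var_y"
  unfolding embed_ty_def
  using eval_poly_hom_const[of embed_t] eval_poly_hom_X[OF ring_hom_embed_t]
    ring_hom_fnD(1)[OF ring_hom_embed_t]
  by auto

definition t_axis_ideal :: "'a::field poly poly poly set" where
  "t_axis_ideal = {p. eval_xy0 p = 0}"

lemma prime_t_axis_ideal: "prime_ideal t_axis_ideal"
  unfolding t_axis_ideal_def by (rule prime_ideal_kernel[OF ring_hom_eval_xy0])

lemma t_axis_ideal_subset:
  fixes J :: "'a::field poly poly poly set"
  assumes J: "is_ideal J" and "var_x \<in> J" "var_y \<in> J"
  shows "t_axis_ideal \<subseteq> J"
proof
  fix p :: "'a poly poly poly" assume "p \<in> t_axis_ideal"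
  then have p: "eval_xy0 p = 0" by (simp add: t_axis_ideal_def)
  have "p - (embed_t \<circ> eval_xy0) p \<in> J"
    by (rule ring_hom_diff_in_ideal[OF ring_hom_fn_id
          ring_hom_fn_comp[OF ring_hom_eval_xy0 ring_hom_embed_t] J])
      (simp_all add: eval_xy0_simps embed_t_simps ring_hom_fnD[OF ring_hom_embed_t] assms
        is_ideal_zero)
  with p show "p \<in> J" by (simp add: ring_hom_fnD[OF ring_hom_embed_t])
qed

definition var_s :: "'a::field poly fract" where
  "var_s = to_fract [:0, 1:]"

lemma var_s_nz: "var_s \<noteq> 0"
  by (simp add: var_s_def)

lemma to_fract_monom: "to_fract (monom c k) = to_fract [:c:] * var_s ^ k"
proof -
  have "monom c k = [:c:] * [:0, 1:] ^ k" by (simp add: monom_altdef)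
  then show ?thesis unfolding var_s_def by (simp only: ring_hom_fnD(4,7)[OF ring_hom_to_fract])
qed

locale quartic_twist =
  fixes a c d :: "'a::field"
  assumes a_nz: "a \<noteq> 0" and c_nz: "c \<noteq> 0"
begin

definition surface_eq :: "'a poly poly poly" where
  "surface_eq = (var_t ^ 4 + cnst c * var_t + cnst d) * var_y ^ 2 - (var_x ^ 3 + cnst a * var_x)"

definition curve_eq :: "'a poly poly poly" where
  "curve_eq = (cnst c * var_t + cnst d) * var_y ^ 2 - cnst a * var_x"

definition curve_ideal :: "'a poly poly poly set" where
  "curve_ideal = ideal_gen {surface_eq, curve_eq}"

definition elim_eq :: "'a poly poly poly" where
  "elim_eq = cnst a ^ 3 * var_t ^ 4 - (cnst c * var_t + cnst d) ^ 3 * var_y ^ 4"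

lemma is_ideal_curve_ideal: "is_ideal curve_ideal"
  unfolding curve_ideal_def by (rule is_ideal_ideal_gen)

lemma surface_eq_in_curve_ideal: "surface_eq \<in> curve_ideal"
  and curve_eq_in_curve_ideal: "curve_eq \<in> curve_ideal"
  unfolding curve_ideal_def using ideal_gen_superset by blast+

lemma y2_elim_eq_in_curve_ideal: "var_y ^ 2 * elim_eq \<in> curve_ideal"
proof -
  define u where "u = (cnst c * var_t + cnst d) * var_y ^ 2"
  have "var_y ^ 2 * elim_eq = cnst a ^ 3 * (surface_eq - curve_eq)
      - curve_eq * (3 * u ^ 2 - 3 * u * curve_eq + curve_eq ^ 2)"
    unfolding surface_eq_def curve_eq_def elim_eq_def u_def by algebra
  also have "\<dots> \<in> curve_ideal"
    using is_ideal_curve_ideal surface_eq_in_curve_ideal curve_eq_in_curve_ideal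
    by (intro is_ideal_diff is_ideal_mult_left is_ideal_mult_right)
  finally show ?thesis .
qed

lemma var_x_in_ideal:
  assumes J: "is_ideal J" and "curve_eq \<in> J" "var_y \<in> J"
  shows "var_x \<in> J"
proof -
  have "cnst (1 / a) * cnst a = (1 :: 'a poly poly poly)"
    using a_nz by (simp flip: ring_hom_fnD(2,4)[OF ring_hom_cnst])
  then have "var_x = cnst (1 / a) * ((cnst c * var_t + cnst d) * var_y * var_y - curve_eq)"
    unfolding curve_eq_def by (simp add: algebra_simps power2_eq_square)
  also have "\<dots> \<in> J" using assms by (intro is_ideal_mult_left is_ideal_diff is_ideal_mult_right)
  finally show ?thesis .
qed

lemma curve_ideal_subset_t_axis: "curve_ideal \<subseteq> t_axis_ideal"
  unfolding curve_ideal_def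
  by (rule ideal_gen_least[OF prime_ideal_is_ideal[OF prime_t_axis_ideal]])
    (simp add: t_axis_ideal_def surface_eq_def curve_eq_def eval_xy0_simps
      ring_hom_fnD[OF ring_hom_eval_xy0])

lemma t_axis_ideal_minimal:
  assumes Q: "prime_ideal Q" "curve_ideal \<subseteq> Q" "Q \<subseteq> t_axis_ideal"
  shows "Q = t_axis_ideal"
proof -
  have "eval_xy0 elim_eq = [:a:] ^ 3 * [:0, 1:] ^ 4"
    unfolding elim_eq_def by (simp add: eval_xy0_simps ring_hom_fnD[OF ring_hom_eval_xy0])
  then have "elim_eq \<notin> Q" using a_nz Q(3) by (auto simp: t_axis_ideal_def)
  then have "var_y * var_y \<in> Q"
    using prime_idealD[OF Q(1)] y2_elim_eq_in_curve_ideal Q(2) by (auto simp: power2_eq_square)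
  then have y: "var_y \<in> Q" using prime_idealD[OF Q(1)] by blast
  have QI: "is_ideal Q" by (rule prime_ideal_is_ideal[OF Q(1)])
  have x: "var_x \<in> Q" using var_x_in_ideal[OF QI _ y] curve_eq_in_curve_ideal Q(2) by blast
  show ?thesis using t_axis_ideal_subset[OF QI x y] Q(3) by blast
qed

lemma radical_eq_t_axis_ideal: "radical (ideal_gen {surface_eq, curve_eq, var_y}) = t_axis_ideal"
proof
  let ?J = "ideal_gen {surface_eq, curve_eq, var_y}"
  have "?J \<subseteq> t_axis_ideal"
    by (rule ideal_gen_least[OF prime_ideal_is_ideal[OF prime_t_axis_ideal]])
      (simp add: t_axis_ideal_def surface_eq_def curve_eq_def eval_xy0_simps
        ring_hom_fnD[OF ring_hom_eval_xy0])
  then show "radical ?J \<subseteq> t_axis_ideal"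
  proof (clarsimp simp: radical_def)
    fix p and n :: nat assume "p ^ n \<in> ?J"
    with \<open>?J \<subseteq> t_axis_ideal\<close> have "eval_xy0 p ^ n = 0"
      by (auto simp: t_axis_ideal_def ring_hom_fnD(7)[OF ring_hom_eval_xy0])
    then show "p \<in> t_axis_ideal" by (simp add: t_axis_ideal_def)
  qed
  have J: "is_ideal ?J" by (rule is_ideal_ideal_gen)
  have gens: "curve_eq \<in> ?J" "var_y \<in> ?J"
    using ideal_gen_superset[of "{surface_eq, curve_eq, var_y}"] by auto
  have "t_axis_ideal \<subseteq> ?J" using t_axis_ideal_subset[OF J var_x_in_ideal[OF J gens] gens(2)] .
  then show "t_axis_ideal \<subseteq> radical ?J"
  proof (clarsimp simp: radical_def)
    fix p :: "'a poly poly poly" assume "p \<in> t_axis_ideal"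
    with \<open>t_axis_ideal \<subseteq> ?J\<close> have "p ^ 1 \<in> ?J" by auto
    then show "\<exists>n. p ^ n \<in> ?J" ..
  qed
qed

text \<open>On the curve the two equations reduce to \<open>x\<^sup>3 = t\<^sup>4 y\<^sup>2\<close> and \<open>a x = (c t + d) y\<^sup>2\<close>.
  The first is parametrised by \<open>x = t\<^sup>2/s\<^sup>2, y = t/s\<^sup>3\<close>, and the second then becomes
  \<open>a s\<^sup>4 = c t + d\<close>.\<close>
definition param_t :: "'a poly" where
  "param_t = monom (a / c) 4 - [:d / c:]"

definition param_T :: "'a poly fract" where
  "param_T = to_fract param_t"

definition param_X :: "'a poly fract" where
  "param_X = param_T ^ 2 / var_s ^ 2"

definition param_Y :: "'a poly fract" where
  "param_Y = param_T / var_s ^ 3"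

definition param_ev :: "'a poly poly poly \<Rightarrow> 'a poly fract" where
  "param_ev = ev3 param_T param_X param_Y"

definition param_ideal :: "'a poly poly poly set" where
  "param_ideal = {p. param_ev p = 0}"

lemma coeff_param_t: "coeff param_t n = (if n = 4 then a / c else if n = 0 then - (d / c) else 0)"
  unfolding param_t_def by (auto simp: coeff_monom coeff_pCons split: nat.splits)

lemma degree_param_t: "degree param_t = 4"
proof (rule antisym)
  show "degree param_t \<le> 4" by (rule degree_le) (simp add: coeff_param_t)
  show "4 \<le> degree param_t" using a_nz c_nz by (intro le_degree) (simp add: coeff_param_t)
qed

lemma param_t_nz: "param_t \<noteq> 0"
  using degree_param_t by auto

lemma param_T_nz: "param_T \<noteq> 0"
  by (simp add: param_T_def param_t_nz)

lemma param_T_equation: "to_fract [:c:] * param_T + to_fract [:d:] = to_fract [:a:] * var_s ^ 4"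
proof -
  have "[:c:] * param_t + [:d:] = monom a 4"
    using c_nz by (simp add: param_t_def algebra_simps mult_monom flip: monom_0)
  from arg_cong[OF this, of to_fract] show ?thesis
    unfolding param_T_def to_fract_monom by (simp only: to_fract_add to_fract_mult)
qed

lemma ring_hom_param_ev: "ring_hom_fn param_ev"
  unfolding param_ev_def by (rule ring_hom_ev3)

lemmas param_ev_simps = ev3_simps[of param_T param_X param_Y, folded param_ev_def]
  ring_hom_fnD[OF ring_hom_param_ev]

lemma param_ev_curve_eq: "param_ev curve_eq = 0"
proof -
  have "param_ev curve_eq = (to_fract [:c:] * param_T + to_fract [:d:]) * param_Y ^ 2
      - to_fract [:a:] * param_X"
    unfolding curve_eq_def by (simp add: param_ev_simps)
  also have "\<dots> = 0"
    unfolding param_T_equation param_X_def param_Y_def using var_s_nz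
    by (simp add: field_simps eval_nat_numeral)
  finally show ?thesis .
qed

lemma param_ev_surface_eq: "param_ev surface_eq = 0"
proof -
  have "param_ev surface_eq = (param_T ^ 4 + (to_fract [:c:] * param_T + to_fract [:d:])) * param_Y ^ 2
      - (param_X ^ 3 + to_fract [:a:] * param_X)"
    unfolding surface_eq_def by (simp add: param_ev_simps add.assoc)
  also have "\<dots> = 0"
    unfolding param_T_equation param_X_def param_Y_def using var_s_nz
    by (simp add: divide_simps eval_nat_numeral) (simp add: algebra_simps)
  finally show ?thesis .
qed

lemma prime_param_ideal: "prime_ideal param_ideal"
  unfolding param_ideal_def by (rule prime_ideal_kernel[OF ring_hom_param_ev])

lemma curve_ideal_subset_param_ideal: "curve_ideal \<subseteq> param_ideal"
  unfolding curve_ideal_def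
  by (rule ideal_gen_least[OF prime_ideal_is_ideal[OF prime_param_ideal]])
    (simp add: param_ideal_def param_ev_surface_eq param_ev_curve_eq)

lemma t_axis_ideal_ne_param_ideal: "t_axis_ideal \<noteq> param_ideal"
proof -
  have "var_x \<in> t_axis_ideal" by (simp add: t_axis_ideal_def eval_xy0_simps)
  moreover have "var_x \<notin> param_ideal"
    using param_T_nz var_s_nz by (simp add: param_ideal_def param_ev_simps param_X_def)
  ultimately show ?thesis by blast
qed

lemma fraction_image_param_ev: "fraction_image param_ev = UNIV"
proof -
  note closed = fraction_image_hom[OF ring_hom_param_ev] fraction_image_add[OF ring_hom_param_ev]
    fraction_image_mult[OF ring_hom_param_ev] fraction_image_divide[OF ring_hom_param_ev]
  have s_eq: "var_s = param_ev var_x / (param_ev var_t * param_ev var_y)"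
    using var_s_nz param_T_nz
    by (simp add: param_ev_simps param_X_def param_Y_def field_simps eval_nat_numeral)
  have s: "var_s \<in> fraction_image param_ev"
    unfolding s_eq by (intro closed)
  have poly: "to_fract P \<in> fraction_image param_ev" for P
  proof (induct P)
    case (pCons k P)
    have "to_fract (pCons k P) = param_ev (cnst k) + var_s * to_fract P"
      by (simp add: param_ev_simps var_s_def flip: to_fract_add to_fract_mult)
    then show ?case using pCons s closed by simp
  qed (use closed(1)[of 0] in \<open>simp add: param_ev_simps\<close>)
  have "z \<in> fraction_image param_ev" for z
    by (cases z) (simp add: Fract_conv_to_fract poly closed(4))
  then show ?thesis by blast
qed

lemma rational_curve_param_ideal: "rational_curve_ideal param_ideal"
proof -
  have "z \<in> fraction_image param_ev" for z
    using fraction_image_param_ev by blast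
  then show ?thesis
    unfolding rational_curve_ideal_def fraction_image_def param_ideal_def param_ev_def by blast
qed

text \<open>Substitutes for \<open>x\<close> the root \<open>(c t + d) y\<^sup>2 / a\<close> of \<open>curve_eq\<close>, written
  \<open>monom [:d / a, c / a:] 2\<close> in \<open>F[t][y]\<close>.\<close>
definition elim_x :: "'a poly poly poly \<Rightarrow> 'a poly poly" where
  "elim_x = eval3 (\<lambda>k. [:[:k:]:]) [:[:0, 1:]:] (monom [:d / a, c / a:] 2) [:0, 1:]"

lemma ring_hom_elim_x: "ring_hom_fn elim_x"
  unfolding elim_x_def by (rule ring_hom_eval3[OF ring_hom_const_poly_poly])

lemma embed_elim_x_congruent:
  assumes Q: "is_ideal Q" "curve_eq \<in> Q"
  shows "p - embed_ty (elim_x p) \<in> Q"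
proof -
  have elim_x_simps: "elim_x (cnst k) = [:[:k:]:]" "elim_x var_t = [:[:0, 1:]:]"
    "elim_x var_x = monom [:d / a, c / a:] 2" "elim_x var_y = [:0, 1:]" for k
    unfolding elim_x_def by (simp_all add: eval3_simps[OF ring_hom_const_poly_poly])
  have "[:d / a, c / a:] = [:d / a:] + [:c / a:] * [:0, 1:]" by simp
  then have "embed_t [:d / a, c / a:] = cnst (d / a) + cnst (c / a) * var_t"
    by (simp only: ring_hom_fnD(3,4)[OF ring_hom_embed_t] embed_t_simps)
  then have "var_x - embed_ty (elim_x var_x)
      = var_x - (cnst (d / a) + cnst (c / a) * var_t) * var_y ^ 2"
    unfolding elim_x_simps embed_ty_def eval_poly_hom_monom[OF ring_hom_embed_t] by simp
  also have "\<dots> = - cnst (1 / a) * curve_eq"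
  proof -
    have "cnst a * cnst (1 / a) = 1" "cnst (d / a) = cnst d * cnst (1 / a)"
      "cnst (c / a) = cnst c * cnst (1 / a)"
      using a_nz by (simp_all flip: ring_hom_fnD(2,4)[OF ring_hom_cnst])
    then show ?thesis unfolding curve_eq_def by algebra
  qed
  finally have "var_x - embed_ty (elim_x var_x) = - cnst (1 / a) * curve_eq" .
  then have x: "var_x - (embed_ty \<circ> elim_x) var_x \<in> Q"
    using is_ideal_mult_left[OF Q, of "- cnst (1 / a)"] by simp
  have "(\<lambda>p. p) p - (embed_ty \<circ> elim_x) p \<in> Q"
    by (rule ring_hom_diff_in_ideal[OF ring_hom_fn_id
          ring_hom_fn_comp[OF ring_hom_elim_x ring_hom_embed_ty] Q(1) _ _ x])
      (simp_all add: elim_x_simps embed_ty_simps embed_t_simps is_ideal_zero[OF Q(1)])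
  then show ?thesis by simp
qed

lemma param_ev_embed_elim_x: "param_ev (embed_ty (elim_x p)) = param_ev p"
proof -
  have "p - embed_ty (elim_x p) \<in> param_ideal"
    by (rule embed_elim_x_congruent[OF prime_ideal_is_ideal[OF prime_param_ideal]])
      (simp add: param_ideal_def param_ev_curve_eq)
  then show ?thesis by (simp add: param_ideal_def param_ev_simps)
qed

lemma param_ev_embed_t: "param_ev (embed_t u) = to_fract (pcompose u param_t)"
proof (induct u)
  case (pCons k u)
  have "embed_t (pCons k u) = cnst k + var_t * embed_t u"
    unfolding embed_t_def by (simp add: eval_poly_hom_pCons ring_hom_fnD[OF ring_hom_cnst])
  with pCons show ?case
    by (simp add: param_ev_simps pcompose_pCons param_T_def)
qed (simp add: ring_hom_fnD[OF ring_hom_embed_t] param_ev_simps)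

lemma param_ev_embed_ty: "param_ev (embed_ty r) = eval_poly_hom (param_ev \<circ> embed_t) param_Y r"
  unfolding embed_ty_def
  by (simp add: eval_poly_hom_comp[OF ring_hom_param_ev] ring_hom_fnD[OF ring_hom_embed_t]
      param_ev_simps)

lemma supp_dvd_param_t: "supp_dvd 4 param_t"
  unfolding supp_dvd_def by (simp add: coeff_param_t)

text \<open>Clearing denominators with \<open>s^9\<close> turns \<open>Y^i\<close> into \<open>T^i s^(9 - 3 i)\<close>, and \<open>T\<close> is a
  polynomial in \<open>s^4\<close>.\<close>
lemma param_ev_embed_ty_eq_0:
  assumes deg: "degree r < 4" and ev: "param_ev (embed_ty r) = 0"
  shows "r = 0"
proof -
  define P where "P i = pcompose (coeff r i) param_t" for i
  have r: "r = [:coeff r 0, coeff r 1, coeff r 2, coeff r 3:]"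
    using deg by (auto simp: poly_eq_iff coeff_pCons coeff_eq_0 eval_nat_numeral split: nat.splits)
  have hom0: "(param_ev \<circ> embed_t) 0 = 0"
    by (simp add: ring_hom_fnD[OF ring_hom_embed_t] param_ev_simps)
  have "var_s ^ 9 * param_ev (embed_ty r)
      = var_s ^ 9 * (to_fract (P 0) + param_Y * (to_fract (P 1)
          + param_Y * (to_fract (P 2) + param_Y * to_fract (P 3))))"
    unfolding param_ev_embed_ty
    by (subst r) (simp add: eval_poly_hom_pCons[where f = "param_ev \<circ> embed_t", OF hom0]
        param_ev_embed_t P_def)
  also have "\<dots> = var_s ^ 9 * to_fract (P 0) + var_s ^ 6 * (to_fract (P 1) * param_T)
      + var_s ^ 3 * (to_fract (P 2) * param_T ^ 2) + to_fract (P 3) * param_T ^ 3"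
  proof -
    have "param_T = var_s ^ 3 * param_Y" by (simp add: param_Y_def var_s_nz)
    then show ?thesis by algebra
  qed
  also have "\<dots> = to_fract (\<Sum>i<4. monom 1 (9 - 3 * i) * (P i * param_t ^ i))"
    by (simp add: eval_nat_numeral to_fract_monom param_T_def ring_hom_fnD[OF ring_hom_to_fract]
        flip: one_pCons)
  finally have "var_s ^ 9 * param_ev (embed_ty r)
      = to_fract (\<Sum>i<4. monom 1 (9 - 3 * i) * (P i * param_t ^ i))" .
  then have "to_fract (\<Sum>i<4. monom 1 (9 - 3 * i) * (P i * param_t ^ i)) = 0"
    by (simp only: ev mult_zero_right)
  then have sum: "(\<Sum>i<4. monom 1 (9 - 3 * i) * (P i * param_t ^ i)) = 0"
    by (simp only: to_fract_eq_0_iff)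
  have inj: "inj_on (\<lambda>i. (9 - 3 * i) mod 4) {..<4::nat}"
    by (simp add: inj_on_def lessThan_nat_numeral)
  have "P i * param_t ^ i = 0" if "i < 4" for i
    using sum_shifted_supp_dvd_eq_0[OF _ _ inj sum] that
    by (simp add: P_def supp_dvd_mult supp_dvd_pcompose supp_dvd_power supp_dvd_param_t)
  then have "coeff r i = 0" if "i < 4" for i
    using that param_t_nz degree_param_t pcompose_eq_0[of "coeff r i" param_t]
    by (auto simp: P_def)
  with deg show "r = 0"
    by (intro poly_eqI) (metis coeff_0 coeff_eq_0 leI le_less_trans)
qed

definition h_ty :: "'a poly poly" where
  "h_ty = [:monom (a ^ 3) 4:] - monom ([:d, c:] ^ 3) 4"

lemma degree_h_ty: "degree h_ty = 4"
proof -
  have "h_ty = [:monom (a ^ 3) 4:] + - monom ([:d, c:] ^ 3) 4" by (simp add: h_ty_def)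
  also have "degree \<dots> = 4"
    using c_nz by (subst degree_add_eq_right) (simp_all add: degree_monom_eq)
  finally show ?thesis .
qed

lemma embed_ty_h_ty: "embed_ty h_ty = elim_eq"
proof -
  have "[:d, c:] = [:d:] + [:c:] * [:0, 1:]" by simp
  then have "embed_t [:d, c:] = cnst c * var_t + cnst d"
    by (simp only: ring_hom_fnD(3,4)[OF ring_hom_embed_t] embed_t_simps add.commute)
  moreover have "embed_t (monom k n) = cnst k * var_t ^ n" for k :: 'a and n
    unfolding embed_t_def by (rule eval_poly_hom_monom[OF ring_hom_cnst])
  moreover have "embed_ty (monom u n) = embed_t u * var_y ^ n" for u :: "'a poly" and n
    unfolding embed_ty_def by (rule eval_poly_hom_monom[OF ring_hom_embed_t])
  ultimately show ?thesis
    unfolding h_ty_def elim_eq_def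
    by (simp only: ring_hom_fnD(6)[OF ring_hom_embed_ty] ring_hom_fnD(7)[OF ring_hom_embed_t]
        ring_hom_fnD(7)[OF ring_hom_cnst] embed_ty_simps)
qed

text \<open>Pseudo-division by \<open>h_ty\<close> leaves a remainder of \<open>y\<close>-degree below 4, which vanishes
  once it lies in \<open>param_ideal\<close>.\<close>
lemma embed_ty_in_prime_ideal:
  assumes Q: "prime_ideal Q" "elim_eq \<in> Q" "Q \<subseteq> param_ideal"
    and ev: "param_ev (embed_ty f) = 0"
  shows "embed_ty f \<in> Q"
proof -
  define r where "r = pseudo_mod f h_ty"
  have h_nz: "h_ty \<noteq> 0" using degree_h_ty by auto
  obtain \<alpha> q where \<alpha>: "\<alpha> \<noteq> 0" and div: "smult \<alpha> f = h_ty * q + r"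
    using pseudo_mod(1)[OF h_nz] unfolding r_def by blast
  have deg: "r = 0 \<or> degree r < 4"
    using pseudo_mod(2)[OF h_nz] degree_h_ty unfolding r_def by simp
  have "smult \<alpha> f = [:\<alpha>:] * f" by simp
  then have "embed_ty (smult \<alpha> f) = embed_t \<alpha> * embed_ty f"
    by (simp only: ring_hom_fnD(4)[OF ring_hom_embed_ty] embed_ty_simps)
  with div have prod: "embed_t \<alpha> * embed_ty f = elim_eq * embed_ty q + embed_ty r"
    by (simp add: ring_hom_fnD[OF ring_hom_embed_ty] embed_ty_h_ty)
  have "param_ev elim_eq = 0" using Q(2,3) by (auto simp: param_ideal_def)
  with ev arg_cong[OF prod, of param_ev] have "param_ev (embed_ty r) = 0"
    by (simp add: param_ev_simps)
  with deg have "r = 0" using param_ev_embed_ty_eq_0 by blast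
  with prod have "embed_t \<alpha> * embed_ty f \<in> Q"
    using is_ideal_mult_right[OF prime_ideal_is_ideal[OF Q(1)] Q(2)]
    by (simp add: ring_hom_fnD[OF ring_hom_embed_ty])
  moreover have "embed_t \<alpha> \<notin> Q"
    using Q(3) \<alpha> pcompose_eq_0[of \<alpha> param_t] degree_param_t
    by (auto simp: param_ideal_def param_ev_embed_t)
  ultimately show ?thesis using prime_idealD[OF Q(1)] by blast
qed

lemma param_ideal_minimal:
  assumes Q: "prime_ideal Q" "curve_ideal \<subseteq> Q" "Q \<subseteq> param_ideal"
  shows "Q = param_ideal"
proof -
  have "var_y \<notin> Q"
    using Q(3) param_T_nz var_s_nz by (auto simp: param_ideal_def param_ev_simps param_Y_def)
  then have "var_y * var_y \<notin> Q" using prime_idealD[OF Q(1)] by blast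
  then have elim: "elim_eq \<in> Q"
    using prime_idealD[OF Q(1)] y2_elim_eq_in_curve_ideal Q(2) by (auto simp: power2_eq_square)
  have curve: "curve_eq \<in> Q" using curve_eq_in_curve_ideal Q(2) by blast
  have "p \<in> Q" if "p \<in> param_ideal" for p
  proof -
    have "embed_ty (elim_x p) \<in> Q"
      using that by (intro embed_ty_in_prime_ideal[OF Q(1) elim Q(3)])
        (simp add: param_ideal_def param_ev_embed_elim_x)
    moreover have "p - embed_ty (elim_x p) \<in> Q"
      by (rule embed_elim_x_congruent[OF prime_ideal_is_ideal[OF Q(1)] curve])
    ultimately show "p \<in> Q"
      using is_ideal_add[OF prime_ideal_is_ideal[OF Q(1)]] by fastforce
  qed
  with Q(3) show ?thesis by blast
qed

end

theorem theorem4p1: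
  fixes a c d :: "'a::field"
  assumes char2: "(2::'a) \<noteq> 0" and char3: "(3::'a) \<noteq> 0"
    and a: "a \<noteq> 0" and c: "c \<noteq> 0" and d: "d \<noteq> 0"
  defines "S \<equiv> (var_t ^ 4 + cnst c * var_t + cnst d) * var_y ^ 2 - (var_x ^ 3 + cnst a * var_x)"
    and "G \<equiv> (cnst c * var_t + cnst d) * var_y ^ 2 - cnst a * var_x"
  shows "\<exists>P1 P2. minimal_prime_over (ideal_gen {S, G}) P1 \<and>
                 minimal_prime_over (ideal_gen {S, G}) P2 \<and> P1 \<noteq> P2 \<and>
                 P1 = radical (ideal_gen {S, G, var_y}) \<and>
                 rational_curve_ideal P2"
proof -
  \<comment> \<open>The argument never divides by 2, 3 or d.\<close>
  interpret quartic_twist a c d using a c by unfold_locales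
  have SG: "S = surface_eq" "G = curve_eq"
    unfolding S_def G_def surface_eq_def curve_eq_def by simp_all
  show ?thesis
  proof (intro exI conjI)
    show "minimal_prime_over (ideal_gen {S, G}) t_axis_ideal"
      unfolding minimal_prime_over_def SG curve_ideal_def[symmetric]
      using prime_t_axis_ideal curve_ideal_subset_t_axis t_axis_ideal_minimal by blast
    show "minimal_prime_over (ideal_gen {S, G}) param_ideal"
      unfolding minimal_prime_over_def SG curve_ideal_def[symmetric]
      using prime_param_ideal curve_ideal_subset_param_ideal param_ideal_minimal by blast
    show "t_axis_ideal \<noteq> param_ideal" by (rule t_axis_ideal_ne_param_ideal)
    show "t_axis_ideal = radical (ideal_gen {S, G, var_y})"
      unfolding SG radical_eq_t_axis_ideal ..
    show "rational_curve_ideal param_ideal" by (rule rational_curve_param_ideal)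
  qed
qed

end
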